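(* For each odd prime $p$ there exists a local nearring $R$ whose additive group $R^+$ is isomorphic to $G_4 = C_p \times ((C_p\times C_p)\rtimes C_p)$, the group of order $p^4$ with presentation $$G_4=\langle a,b,d \colon a^p=b^p=c^p=d^p=[a,c]=[b,c]=[a,d]=[b,d]=[c,d]=e\rangle,\quad c=[a,b].$$
   Context: A (left) nearring is a non-empty set $R$ with two binary operations $+$ and $\cdot$ such that $(R,+)$ is a (not necessarily abelian) group with neutral element $0$, $(R,\cdot)$ is a semigroup, and $x\cdot(y+z)=x\cdot y+x\cdot z$ for all $x,y,z\in R$. The group $(R,+)$ is denoted $R^+$ and called the additive group of $R$. $R$ is a nearring with identity if $(R,\cdot)$ is a monoid. A nearring $R$ with identity is local if the set $L$ of all elements of $R$ that are not invertible in the monoid $(R,\cdot)$ is a subgroup of $R^+$. $C_n$ is the cyclic group of order $n$, and $[a,b]=a^{-1}b^{-1}ab$. *)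

theory Defs
  imports "HOL-Algebra.Ring" "HOL-Algebra.Elementary_Groups" "HOL-Computational_Algebra.Primes"
begin

text \<open>
  The record type of rings is reused for left nearrings; the field \<open>one\<close> carries no meaning until
  an identity is required. Neither commutativity of addition nor \<open>\<zero> \<otimes> x = \<zero>\<close> is assumed.
\<close>

locale nearring =
  fixes R (structure)
  assumes additive_group: "group (add_monoid R)"
    and mult_closed: "\<lbrakk>x \<in> carrier R; y \<in> carrier R\<rbrakk> \<Longrightarrow> x \<otimes> y \<in> carrier R"
    and mult_assoc: "\<lbrakk>x \<in> carrier R; y \<in> carrier R; z \<in> carrier R\<rbrakk>
      \<Longrightarrow> (x \<otimes> y) \<otimes> z = x \<otimes> (y \<otimes> z)"
    and left_distrib: "\<lbrakk>x \<in> carrier R; y \<in> carrier R; z \<in> carrier R\<rbrakk>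
      \<Longrightarrow> x \<otimes> (y \<oplus> z) = x \<otimes> y \<oplus> x \<otimes> z"

locale nearring_with_identity = nearring R + monoid R for R (structure)

locale local_nearring = nearring_with_identity +
  assumes nonunits_subgroup: "subgroup (carrier R - Units R) (add_monoid R)"

text \<open>
  A letter \<open>(x, False)\<close> stands for the generator \<open>x\<close> and \<open>(x, True)\<close> for its formal inverse.
  Words modulo the congruence generated by free cancellation and the relators are the
  quotient of the free group by the normal closure of the relators.
\<close>

type_synonym 'x gword = "('x \<times> bool) list"

inductive pres_eq :: "'x gword set \<Rightarrow> 'x gword \<Rightarrow> 'x gword \<Rightarrow> bool" for Rel where
  refl: "pres_eq Rel u u"
| sym: "pres_eq Rel u v \<Longrightarrow> pres_eq Rel v u"
| trans: "pres_eq Rel u v \<Longrightarrow> pres_eq Rel v w \<Longrightarrow> pres_eq Rel u w"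
| congr: "pres_eq Rel u v \<Longrightarrow> pres_eq Rel (x @ u @ y) (x @ v @ y)"
| cancel: "pres_eq Rel [(g, s), (g, \<not> s)] []"
| relator: "r \<in> Rel \<Longrightarrow> pres_eq Rel r []"

definition pres_rel :: "'x gword set \<Rightarrow> ('x gword \<times> 'x gword) set" where
  "pres_rel Rel = {(u, v). pres_eq Rel u v}"

definition presented_group :: "'x gword set \<Rightarrow> 'x gword set monoid" where
  "presented_group Rel =
     \<lparr>carrier = UNIV // pres_rel Rel,
      monoid.mult = (\<lambda>A B. \<Union>u\<in>A. \<Union>v\<in>B. pres_rel Rel `` {u @ v}),
      one = pres_rel Rel `` {[]}\<rparr>"

definition gen :: "'x \<Rightarrow> 'x gword" where
  "gen x = [(x, False)]"

definition inv_word :: "'x gword \<Rightarrow> 'x gword" where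
  "inv_word w = rev (map (\<lambda>(x, s). (x, \<not> s)) w)"

definition pow_word :: "'x gword \<Rightarrow> nat \<Rightarrow> 'x gword" where
  "pow_word w n = concat (replicate n w)"

definition comm_word :: "'x gword \<Rightarrow> 'x gword \<Rightarrow> 'x gword" where
  "comm_word u v = inv_word u @ inv_word v @ u @ v"

lemma equiv_pres_rel: "equiv UNIV (pres_rel Rel)"
  unfolding pres_rel_def
  by (rule equivI) (auto intro!: refl_onI symI transI intro: pres_eq.intros)

lemma pres_rel_class_eq: "pres_rel Rel `` {u} = pres_rel Rel `` {v} \<longleftrightarrow> pres_eq Rel u v"
  using eq_equiv_class_iff[OF equiv_pres_rel, of u v Rel] by (simp add: pres_rel_def)

lemma pres_eq_append: "pres_eq Rel u u' \<Longrightarrow> pres_eq Rel v v' \<Longrightarrow> pres_eq Rel (u @ v) (u' @ v')"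
  using pres_eq.congr[of Rel u u' "[]" v] pres_eq.congr[of Rel v v' u' "[]"]
  by (auto intro: pres_eq.trans)

lemma mult_presented_group:
  "pres_rel Rel `` {u} \<otimes>\<^bsub>presented_group Rel\<^esub> pres_rel Rel `` {v} = pres_rel Rel `` {u @ v}"
proof -
  have "pres_rel Rel `` {u' @ v'} = pres_rel Rel `` {u @ v}"
    if "u' \<in> pres_rel Rel `` {u}" "v' \<in> pres_rel Rel `` {v}" for u' v'
    using that unfolding pres_rel_class_eq
    by (auto simp: pres_rel_def intro: pres_eq_append pres_eq.sym)
  moreover have "u \<in> pres_rel Rel `` {u}" "v \<in> pres_rel Rel `` {v}"
    by (auto simp: pres_rel_def intro: pres_eq.refl)
  ultimately show ?thesis
    unfolding presented_group_def monoid.simps by blast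
qed

lemma inv_word_cancel: "pres_eq Rel (inv_word w @ w) []"
proof (induction w)
  case Nil
  show ?case by (simp add: inv_word_def pres_eq.refl)
next
  case (Cons l w)
  obtain x s where l: "l = (x, s)" by (cases l)
  have "pres_eq Rel (inv_word w @ [(x, \<not> s), (x, \<not> \<not> s)] @ w) (inv_word w @ [] @ w)"
    by (rule pres_eq.congr[OF pres_eq.cancel])
  then show ?case
    using Cons l by (auto simp: inv_word_def intro: pres_eq.trans)
qed

lemma group_presented_group: "group (presented_group Rel)"
proof (rule groupI)
  let ?G = "presented_group Rel"
  have car: "A \<in> carrier ?G \<longleftrightarrow> (\<exists>u. A = pres_rel Rel `` {u})" for A
    by (auto simp: presented_group_def quotient_def)
  have one: "\<one>\<^bsub>?G\<^esub> = pres_rel Rel `` {[]}"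
    by (simp add: presented_group_def)
  show "A \<otimes>\<^bsub>?G\<^esub> B \<in> carrier ?G" if "A \<in> carrier ?G" "B \<in> carrier ?G" for A B
    using that by (metis car mult_presented_group)
  show "\<one>\<^bsub>?G\<^esub> \<in> carrier ?G"
    using car one by blast
  show "A \<otimes>\<^bsub>?G\<^esub> B \<otimes>\<^bsub>?G\<^esub> C = A \<otimes>\<^bsub>?G\<^esub> (B \<otimes>\<^bsub>?G\<^esub> C)"
    if "A \<in> carrier ?G" "B \<in> carrier ?G" "C \<in> carrier ?G" for A B C
    using that by (auto simp: car mult_presented_group)
  show "\<one>\<^bsub>?G\<^esub> \<otimes>\<^bsub>?G\<^esub> A = A" if "A \<in> carrier ?G" for A
    using that by (auto simp: car one mult_presented_group)
  show "\<exists>B\<in>carrier ?G. B \<otimes>\<^bsub>?G\<^esub> A = \<one>\<^bsub>?G\<^esub>" if "A \<in> carrier ?G" for A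
  proof -
    from that obtain w where A: "A = pres_rel Rel `` {w}" by (auto simp: car)
    have "pres_rel Rel `` {inv_word w} \<otimes>\<^bsub>?G\<^esub> A = \<one>\<^bsub>?G\<^esub>"
      by (simp add: A one mult_presented_group pres_rel_class_eq inv_word_cancel)
    then show ?thesis using car by blast
  qed
qed

datatype G4_gen = Gen_a | Gen_b | Gen_d

definition G4_relators :: "nat \<Rightarrow> G4_gen gword set" where
  "G4_relators p =
     (let a = gen Gen_a; b = gen Gen_b; d = gen Gen_d; c = comm_word a b in
      {pow_word a p, pow_word b p, pow_word c p, pow_word d p,
       comm_word a c, comm_word b c, comm_word a d, comm_word b d, comm_word c d})"

definition G4 :: "nat \<Rightarrow> G4_gen gword set monoid" where
  "G4 p = presented_group (G4_relators p)"

definition semidirect ::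
  "('a, 'm) monoid_scheme \<Rightarrow> ('b, 'n) monoid_scheme \<Rightarrow> ('b \<Rightarrow> 'a \<Rightarrow> 'a) \<Rightarrow> ('a \<times> 'b) monoid" where
  "semidirect N H \<theta> =
     \<lparr>carrier = carrier N \<times> carrier H,
      monoid.mult = (\<lambda>(n, h) (n', h'). (n \<otimes>\<^bsub>N\<^esub> \<theta> h n', h \<otimes>\<^bsub>H\<^esub> h')),
      one = (\<one>\<^bsub>N\<^esub>, \<one>\<^bsub>H\<^esub>)\<rparr>"

text \<open>
  In \<open>(C\<^sub>p \<times> C\<^sub>p) \<rtimes> C\<^sub>p\<close> the normal factor is generated by \<open>b = (1, 0)\<close> and
  \<open>c = (0, 1)\<close>, and the complement by \<open>a\<close>, acting by \<open>a b a\<^sup>-\<^sup>1 = b c\<close> and \<open>a c a\<^sup>-\<^sup>1 = c\<close>; this is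
  what \<open>c = a\<^sup>-\<^sup>1 b\<^sup>-\<^sup>1 a b\<close> with \<open>c\<close> central amounts to.
\<close>

definition shear :: "nat \<Rightarrow> int \<Rightarrow> int \<times> int \<Rightarrow> int \<times> int" where
  "shear p k = (\<lambda>(x, y). (x, (y + k * x) mod int p))"

definition G4_product :: "nat \<Rightarrow> (int \<times> (int \<times> int) \<times> int) monoid" where
  "G4_product p =
     (let C = integer_mod_group p in C \<times>\<times> semidirect (C \<times>\<times> C) C (shear p))"

end

theory Submission
  imports Defs "HOL-Algebra.Weak_Morphisms" "HOL-Library.Countable"
begin

text \<open>
  A left nearring with identity \<open>i\<close> on a group \<open>G\<close> is the same as a monoid of endomorphisms \<open>\<phi>\<^sub>x\<close>
  of \<open>G\<close>, one for every \<open>x \<in> G\<close>, with \<open>\<phi>\<^sub>x(i) = x\<close>; the product is \<open>x y = \<phi>\<^sub>x(y)\<close>. For odd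
  \<open>p\<close>, \<open>G\<^sub>4\<close> can be written on \<open>(\<int>/p)\<^sup>4\<close> with the bilinear group law
  \<open>(l, x, y, k) + (l', x', y', k') = (l + l', x + x', y + y' + k x' - x k', k + k')\<close>, whose
  endomorphisms include all linear maps that preserve the associated Lie bracket. With
  \<open>i = (0, 0, 0, 1)\<close>, the map sending \<open>i\<close> to \<open>(l, x, y, k)\<close> and acting on the other three basis
  vectors as multiplication by \<open>k\<close>, \<open>k\<close> and \<open>k\<^sup>2\<close> is such a map, and these maps are closed under
  composition. The non-units are the kernel of the projection to \<open>k\<close>.

  The presented group maps onto the concrete one, and has at most \<open>p\<^sup>4\<close> elements because every
  word can be brought to the form \<open>d\<^sup>l b\<^sup>x c\<^sup>y a\<^sup>k\<close>.
\<close>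

section \<open>Evaluating words in a group\<close>

definition word_eval :: "('a, 'm) monoid_scheme \<Rightarrow> ('x \<Rightarrow> 'a) \<Rightarrow> 'x gword \<Rightarrow> 'a" where
  "word_eval G f w =
     foldr (\<lambda>(x, s) h. (if s then inv\<^bsub>G\<^esub> (f x) else f x) \<otimes>\<^bsub>G\<^esub> h) w \<one>\<^bsub>G\<^esub>"

context group
begin

context
  fixes f :: "'x \<Rightarrow> 'a"
  assumes f: "\<And>x. f x \<in> carrier G"
begin

lemma word_eval_closed: "word_eval G f w \<in> carrier G"
  by (induction w) (auto simp: word_eval_def f)

lemma word_eval_append: "word_eval G f (u @ v) = word_eval G f u \<otimes> word_eval G f v"
proof (induction u)
  case Nil
  show ?case using word_eval_closed[of v] by (simp add: word_eval_def)
next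
  case (Cons l u)
  then show ?case
    using word_eval_closed[of u] word_eval_closed[of v]
    by (cases l) (auto simp: word_eval_def f m_assoc)
qed

lemma word_eval_Nil: "word_eval G f [] = \<one>"
  by (simp add: word_eval_def)

lemma word_eval_gen: "word_eval G f (gen x) = f x"
  by (simp add: word_eval_def gen_def f)

lemma word_eval_pow_word: "word_eval G f (pow_word w n) = word_eval G f w [^] n"
proof (induction n)
  case (Suc n)
  then show ?case
    unfolding nat_pow_Suc2[OF word_eval_closed] by (simp add: pow_word_def word_eval_append)
qed (simp add: pow_word_def word_eval_Nil)

text \<open>Well-definedness half of von Dyck's theorem. The closure rules of \<open>pres_eq\<close>
  hold for equality of values in any group, so only the relators require an assumption on
  \<open>f\<close>.\<close>

lemma word_eval_pres_eq:
  assumes "\<And>r. r \<in> Rel \<Longrightarrow> word_eval G f r = \<one>" and "pres_eq Rel u v"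
  shows "word_eval G f u = word_eval G f v"
  using assms(2)
proof induction
  case (cancel g s)
  then show ?case by (cases s) (simp_all add: word_eval_def f)
qed (simp_all add: word_eval_append word_eval_Nil assms(1))

lemma word_eval_inv_word: "word_eval G f (inv_word w) = inv (word_eval G f w)"
proof -
  \<comment> \<open>With the empty set of relators the hypothesis of
    \<open>word_eval_pres_eq\<close> is vacuous, so free cancellation alone gives the
    inverse.\<close>
  have "word_eval G f (inv_word w) \<otimes> word_eval G f w = \<one>"
    using word_eval_pres_eq[of "{}", OF _ inv_word_cancel[of "{}" w]]
    by (simp add: word_eval_append word_eval_Nil)
  then show ?thesis
    by (metis inv_equality word_eval_closed)
qed

lemma word_eval_comm_word:
  "word_eval G f (comm_word u v) = inv (word_eval G f v \<otimes> word_eval G f u) \<otimes> (word_eval G f u \<otimes> word_eval G f v)"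
  by (simp add: comm_word_def word_eval_append word_eval_inv_word word_eval_closed
      inv_mult_group m_assoc)

lemma word_eval_comm_word_eq_one:
  "word_eval G f (comm_word u v) = \<one> \<longleftrightarrow>
     word_eval G f u \<otimes> word_eval G f v = word_eval G f v \<otimes> word_eval G f u"
  unfolding word_eval_comm_word
  by (metis inv_closed inv_solve_left l_inv m_closed one_closed r_one word_eval_closed)

text \<open>Von Dyck's theorem: a class is sent to the value of any representative. The choice made
  by \<open>SOME\<close> does not matter, because \<open>pres_eq\<close> words have equal
  values.\<close>

lemma presented_group_hom:
  assumes "\<And>r. r \<in> Rel \<Longrightarrow> word_eval G f r = \<one>"
  shows "\<exists>\<phi> \<in> hom (presented_group Rel) G. \<forall>w. \<phi> (pres_rel Rel `` {w}) = word_eval G f w"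
proof -
  define \<phi> where "\<phi> A = word_eval G f (SOME w. w \<in> A)" for A
  have \<phi>: "\<phi> (pres_rel Rel `` {w}) = word_eval G f w" for w
  proof -
    have "w \<in> pres_rel Rel `` {w}"
      by (simp add: pres_rel_def pres_eq.refl)
    then have "(SOME v. v \<in> pres_rel Rel `` {w}) \<in> pres_rel Rel `` {w}"
      by (rule someI)
    then show ?thesis
      using word_eval_pres_eq[OF assms] by (simp add: \<phi>_def pres_rel_def)
  qed
  have "\<phi> \<in> hom (presented_group Rel) G"
  proof (rule homI)
    fix A B assume "A \<in> carrier (presented_group Rel)" "B \<in> carrier (presented_group Rel)"
    then obtain u v where "A = pres_rel Rel `` {u}" "B = pres_rel Rel `` {v}"
      by (auto simp: presented_group_def quotient_def)
    then show "\<phi> A \<in> carrier G" "\<phi> (A \<otimes>\<^bsub>presented_group Rel\<^esub> B) = \<phi> A \<otimes> \<phi> B"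
      by (simp_all add: mult_presented_group \<phi> word_eval_closed word_eval_append)
  qed
  with \<phi> show ?thesis by blast
qed

end

text \<open>An inverse letter acts as the (n-1)-st power of its generator, since every generator has
  \<open>n\<close>-th power one. Closure of \<open>S\<close> under left multiplication by the
  generators themselves is therefore enough.\<close>

lemma word_eval_induct:
  assumes f: "\<And>x. f x \<in> carrier G"
    and tors: "\<And>x. f x [^] (n::nat) = \<one>" and n: "n > 0"
    and one: "\<one> \<in> S" and S: "S \<subseteq> carrier G"
    and step: "\<And>x s. s \<in> S \<Longrightarrow> f x \<otimes> s \<in> S"
  shows "word_eval G f w \<in> S"
proof (induction w)
  case Nil
  show ?case using one by (simp add: word_eval_def)
next
  case (Cons l w)
  obtain x s where l: "l = (x, s)" by (cases l)
  have pow: "f x [^] (m::nat) \<otimes> t \<in> S" if "t \<in> S" for m t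
  proof (induction m)
    case 0
    show ?case using that S by auto
  next
    case (Suc m)
    have "f x [^] Suc m \<otimes> t = f x \<otimes> (f x [^] m \<otimes> t)"
      unfolding nat_pow_Suc2[OF f] using that S f[of x] by (intro m_assoc) auto
    with step[OF Suc] show ?case by simp
  qed
  have "f x [^] (n - 1) \<otimes> f x = \<one>"
    using tors[of x] n nat_pow_Suc[of "f x" "n - 1"] by simp
  then have "inv (f x) = f x [^] (n - 1)"
    using f by (simp add: inv_equality)
  then show ?case
    using Cons step pow[of _ "n - 1"] by (cases s) (simp_all add: l word_eval_def)
qed

lemma pow_mod_eq:
  assumes "x \<in> carrier G" "x [^] (n::nat) = \<one>"
  shows "x [^] (m mod n) = x [^] (m::nat)"
proof -
  have "x [^] m = x [^] (n * (m div n) + m mod n)"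
    by simp
  also have "\<dots> = (x [^] n) [^] (m div n) \<otimes> x [^] (m mod n)"
    using assms(1) by (simp add: nat_pow_mult nat_pow_pow)
  finally show ?thesis
    using assms by simp
qed

end

section \<open>The presented group as a target of evaluation\<close>

lemma presented_group_carrier: "carrier (presented_group Rel) = range (\<lambda>w. pres_rel Rel `` {w})"
  by (auto simp: presented_group_def quotient_def)

text \<open>Evaluation at the classes of the generators is the quotient map. This makes the group
  lemmas on evaluation, including the induction over words, available inside the presented group
  itself.\<close>

lemma word_eval_presented_group:
  "word_eval (presented_group Rel) (\<lambda>x. pres_rel Rel `` {gen x}) w = pres_rel Rel `` {w}"
    (is "word_eval ?G ?f w = _")
proof (induction w)
  case Nil
  show ?case by (simp add: word_eval_def presented_group_def)
next
  case (Cons l w)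
  interpret G: group ?G by (rule group_presented_group)
  have car: "pres_rel Rel `` {u} \<in> carrier ?G" for u
    by (auto simp: presented_group_def quotient_def)
  obtain x s where l: "l = (x, s)" by (cases l)
  have "\<one>\<^bsub>?G\<^esub> = pres_rel Rel `` {[]}"
    by (simp add: presented_group_def)
  then have "pres_rel Rel `` {[(x, True)]} \<otimes>\<^bsub>?G\<^esub> ?f x = \<one>\<^bsub>?G\<^esub>"
    using pres_eq.cancel[of Rel x True]
    by (simp add: mult_presented_group gen_def pres_rel_class_eq)
  then have "inv\<^bsub>?G\<^esub> (?f x) = pres_rel Rel `` {[(x, True)]}"
    by (intro G.inv_equality car)
  then have "(if s then inv\<^bsub>?G\<^esub> (?f x) else ?f x) = pres_rel Rel `` {[l]}"
    by (simp add: l gen_def)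
  then show ?case
    using Cons by (simp add: word_eval_def l mult_presented_group)
qed

section \<open>The presentation of G4\<close>

text \<open>The factor \<open>a\<close> stands last, so that a generator multiplied from the left
  meets a non-commuting pair only when \<open>a\<close> passes a power of \<open>b\<close>.
  Exponents are natural numbers; reduction modulo \<open>p\<close> is a separate step.\<close>

definition G4_normal_form :: "('a, 'm) monoid_scheme \<Rightarrow> 'a \<Rightarrow> 'a \<Rightarrow> 'a \<Rightarrow> 'a \<Rightarrow>
    nat \<times> (nat \<times> nat) \<times> nat \<Rightarrow> 'a" where
  "G4_normal_form G a b c d = (\<lambda>(l, (x, y), k).
     d [^]\<^bsub>G\<^esub> l \<otimes>\<^bsub>G\<^esub> (b [^]\<^bsub>G\<^esub> x \<otimes>\<^bsub>G\<^esub> (c [^]\<^bsub>G\<^esub> y \<otimes>\<^bsub>G\<^esub> a [^]\<^bsub>G\<^esub> k)))"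

text \<open>Multiplication by \<open>d\<close> or \<open>b\<close> raises one exponent. To reach its
  place, \<open>a\<close> must cross \<open>x\<close> copies of \<open>b\<close>, and each crossing
  leaves one \<open>c\<close> behind, which gives the exponent \<open>x + y\<close>.\<close>

lemma (in group) G4_normal_form_mult:
  assumes [simp]: "a \<in> carrier G" "b \<in> carrier G" "c \<in> carrier G" "d \<in> carrier G"
    and ab: "a \<otimes> b = b \<otimes> c \<otimes> a" and ac: "a \<otimes> c = c \<otimes> a" and bc: "b \<otimes> c = c \<otimes> b"
    and ad: "a \<otimes> d = d \<otimes> a" and bd: "b \<otimes> d = d \<otimes> b"
  shows "d \<otimes> G4_normal_form G a b c d (l, (x, y), k) = G4_normal_form G a b c d (Suc l, (x, y), k)"
    and "b \<otimes> G4_normal_form G a b c d (l, (x, y), k) = G4_normal_form G a b c d (l, (Suc x, y), k)"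
    and "a \<otimes> G4_normal_form G a b c d (l, (x, y), k) = G4_normal_form G a b c d (l, (x, x + y), Suc k)"
proof -
  have dl: "b \<otimes> d [^] l = d [^] l \<otimes> b" "a \<otimes> d [^] l = d [^] l \<otimes> a"
    using group_commutes_pow[of d b l] group_commutes_pow[of d a l] ad bd by simp_all
  have cy: "a \<otimes> c [^] n = c [^] n \<otimes> a" "b \<otimes> c [^] n = c [^] n \<otimes> b" for n :: nat
    using group_commutes_pow[of c a n] group_commutes_pow[of c b n] ac bc by simp_all
  have bx: "a \<otimes> b [^] x = b [^] x \<otimes> (c [^] x \<otimes> a)"
  proof (induction x)
    case 0
    show ?case by simp
  next
    case (Suc x)
    have "a \<otimes> b [^] Suc x = b [^] x \<otimes> (c [^] x \<otimes> (a \<otimes> b))"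
      using Suc by (simp add: m_assoc[symmetric])
    also have "\<dots> = b [^] x \<otimes> ((c [^] x \<otimes> b) \<otimes> (c \<otimes> a))"
      by (simp add: ab m_assoc)
    also have "\<dots> = b [^] Suc x \<otimes> (c [^] Suc x \<otimes> a)"
      by (simp add: cy(2)[symmetric] m_assoc)
    finally show ?case .
  qed
  show "d \<otimes> G4_normal_form G a b c d (l, (x, y), k) = G4_normal_form G a b c d (Suc l, (x, y), k)"
    unfolding G4_normal_form_def prod.case nat_pow_Suc2[OF assms(4)] by (simp add: m_assoc)
  have "b \<otimes> (d [^] l \<otimes> w) = d [^] l \<otimes> (b \<otimes> w)" if "w \<in> carrier G" for w
    using that dl(1) by (simp add: m_assoc[symmetric])
  then show "b \<otimes> G4_normal_form G a b c d (l, (x, y), k) = G4_normal_form G a b c d (l, (Suc x, y), k)"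
    unfolding G4_normal_form_def prod.case nat_pow_Suc2[OF assms(2)] by (simp add: m_assoc)
  have "a \<otimes> (d [^] l \<otimes> w) = d [^] l \<otimes> (a \<otimes> w)" if "w \<in> carrier G" for w
    using that dl(2) by (simp add: m_assoc[symmetric])
  moreover have "a \<otimes> (b [^] x \<otimes> w) = b [^] x \<otimes> (c [^] x \<otimes> (a \<otimes> w))" if "w \<in> carrier G" for w
    using that bx by (simp add: m_assoc[symmetric])
  moreover have "a \<otimes> (c [^] y \<otimes> w) = c [^] y \<otimes> (a \<otimes> w)" if "w \<in> carrier G" for w
    using that cy(1) by (simp add: m_assoc[symmetric])
  moreover have "c [^] (x + y) \<otimes> w = c [^] x \<otimes> (c [^] y \<otimes> w)" if "w \<in> carrier G" for w
    using that by (simp add: nat_pow_mult[symmetric] m_assoc)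
  ultimately show "a \<otimes> G4_normal_form G a b c d (l, (x, y), k)
      = G4_normal_form G a b c d (l, (x, x + y), Suc k)"
    unfolding G4_normal_form_def prod.case nat_pow_Suc2[OF assms(1)] by simp
qed

section \<open>The relators as equations, and the bound on the order\<close>

fun gen_image :: "'a \<Rightarrow> 'a \<Rightarrow> 'a \<Rightarrow> G4_gen \<Rightarrow> 'a" where
  "gen_image a b d Gen_a = a"
| "gen_image a b d Gen_b = b"
| "gen_image a b d Gen_d = d"

text \<open>Needed in both directions: in the presented group it extracts the relations between the
  generators, in the concrete group it reduces the relators to computations with tuples.\<close>

lemma (in group) G4_relators_iff:
  fixes f :: "G4_gen \<Rightarrow> 'a" and p :: nat
  defines "a \<equiv> f Gen_a" and "b \<equiv> f Gen_b" and "d \<equiv> f Gen_d"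
  defines "c \<equiv> inv (b \<otimes> a) \<otimes> (a \<otimes> b)"
  assumes f: "\<And>x. f x \<in> carrier G"
  shows "(\<forall>r\<in>G4_relators p. word_eval G f r = \<one>) \<longleftrightarrow>
    a [^] p = \<one> \<and> b [^] p = \<one> \<and> c [^] p = \<one> \<and> d [^] p = \<one> \<and>
    a \<otimes> c = c \<otimes> a \<and> b \<otimes> c = c \<otimes> b \<and> a \<otimes> d = d \<otimes> a \<and> b \<otimes> d = d \<otimes> b \<and> c \<otimes> d = d \<otimes> c"
  \<comment> \<open>Two passes: commutator relators first become commutation equations while the
    inner word for \<open>c\<close> stays folded; only then is that word evaluated.\<close>
  unfolding G4_relators_def Let_def
  by (simp add: word_eval_pow_word[OF f] word_eval_comm_word_eq_one[OF f])
    (simp add: word_eval_comm_word[OF f] word_eval_gen[OF f] a_def b_def c_def d_def)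

text \<open>The normal forms contain one and are closed under left multiplication by generators, so
  they exhaust the group. Torsion reduces the four exponents modulo \<open>p\<close>.\<close>

lemma card_G4_le:
  assumes "p > 0"
  shows "finite (carrier (G4 p)) \<and> card (carrier (G4 p)) \<le> p ^ 4"
proof -
  let ?G = "G4 p" and ?f = "\<lambda>x. pres_rel (G4_relators p) `` {gen x}"
  interpret G: group ?G
    unfolding G4_def by (rule group_presented_group)
  have f: "?f x \<in> carrier ?G" for x
    by (auto simp: G4_def presented_group_def quotient_def)
  have eval: "word_eval ?G ?f w = pres_rel (G4_relators p) `` {w}" for w
    unfolding G4_def by (rule word_eval_presented_group)
  define a b d where abd: "a = ?f Gen_a" "b = ?f Gen_b" "d = ?f Gen_d"
  define c where "c = inv\<^bsub>?G\<^esub> (b \<otimes>\<^bsub>?G\<^esub> a) \<otimes>\<^bsub>?G\<^esub> (a \<otimes>\<^bsub>?G\<^esub> b)"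
  have [simp]: "a \<in> carrier ?G" "b \<in> carrier ?G" "d \<in> carrier ?G"
    unfolding abd by (rule f)+
  then have [simp]: "c \<in> carrier ?G"
    by (simp add: c_def)
  have "\<forall>r\<in>G4_relators p. word_eval ?G ?f r = \<one>\<^bsub>?G\<^esub>"
    unfolding eval by (auto simp: G4_def presented_group_def pres_rel_class_eq pres_eq.relator)
  then have tors: "a [^]\<^bsub>?G\<^esub> p = \<one>\<^bsub>?G\<^esub>" "b [^]\<^bsub>?G\<^esub> p = \<one>\<^bsub>?G\<^esub>" "c [^]\<^bsub>?G\<^esub> p = \<one>\<^bsub>?G\<^esub>" "d [^]\<^bsub>?G\<^esub> p = \<one>\<^bsub>?G\<^esub>"
    and comm: "a \<otimes>\<^bsub>?G\<^esub> c = c \<otimes>\<^bsub>?G\<^esub> a" "b \<otimes>\<^bsub>?G\<^esub> c = c \<otimes>\<^bsub>?G\<^esub> b" "a \<otimes>\<^bsub>?G\<^esub> d = d \<otimes>\<^bsub>?G\<^esub> a"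
      "b \<otimes>\<^bsub>?G\<^esub> d = d \<otimes>\<^bsub>?G\<^esub> b"
    unfolding G.G4_relators_iff[OF f] abd[symmetric] c_def[symmetric] by simp_all
  \<comment> \<open>The definition of \<open>c\<close> says \<open>ab = bac\<close>; since
    \<open>a\<close> and \<open>c\<close> commute, this is the rewriting rule
    \<open>ab = bca\<close>.\<close>
  have "b \<otimes>\<^bsub>?G\<^esub> c \<otimes>\<^bsub>?G\<^esub> a = (b \<otimes>\<^bsub>?G\<^esub> a) \<otimes>\<^bsub>?G\<^esub> c"
    using comm(1) by (simp add: G.m_assoc)
  also have "\<dots> = a \<otimes>\<^bsub>?G\<^esub> b"
    by (simp add: c_def G.m_assoc[symmetric])
  finally have ab: "a \<otimes>\<^bsub>?G\<^esub> b = b \<otimes>\<^bsub>?G\<^esub> c \<otimes>\<^bsub>?G\<^esub> a" ..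
  let ?N = "G4_normal_form ?G a b c d"
  have N_closed: "?N t \<in> carrier ?G" for t
    by (auto simp: G4_normal_form_def split: prod.split)
  note step = G.G4_normal_form_mult[OF _ _ _ _ ab comm(1,2,3,4)]
  have eval_N: "word_eval ?G ?f w \<in> range ?N" for w
  proof (rule G.word_eval_induct[OF f _ assms])
    show "?f x [^]\<^bsub>?G\<^esub> p = \<one>\<^bsub>?G\<^esub>" for x
      using tors by (cases x) (simp_all add: abd)
    show "\<one>\<^bsub>?G\<^esub> \<in> range ?N"
      by (rule range_eqI[of _ _ "(0, (0, 0), 0)"]) (simp add: G4_normal_form_def)
    show "range ?N \<subseteq> carrier ?G"
      using N_closed by auto
    show "?f x \<otimes>\<^bsub>?G\<^esub> s \<in> range ?N" if "s \<in> range ?N" for x s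
    proof -
      obtain l m n k where s: "s = ?N (l, (m, n), k)"
        using \<open>s \<in> range ?N\<close> by auto
      show ?thesis
        by (cases x) (simp_all add: s step abd[symmetric])
    qed
  qed
  have N_mod: "?N t \<in> ?N ` ({..<p} \<times> ({..<p} \<times> {..<p}) \<times> {..<p})" for t
  proof -
    obtain l m n k where t: "t = (l, (m, n), k)"
      by (metis prod.exhaust)
    have "?N t = ?N (l mod p, (m mod p, n mod p), k mod p)"
      unfolding t by (simp add: G4_normal_form_def G.pow_mod_eq tors)
    then show ?thesis
      using assms by auto
  qed
  have "carrier ?G \<subseteq> ?N ` ({..<p} \<times> ({..<p} \<times> {..<p}) \<times> {..<p})"
  proof
    fix g assume "g \<in> carrier ?G"
    then obtain w where "g = pres_rel (G4_relators p) `` {w}"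
      unfolding G4_def presented_group_carrier by (rule rangeE)
    then have "g \<in> range ?N"
      using eval_N[of w] unfolding eval by (rule ssubst)
    then obtain t where "g = ?N t"
      by (rule rangeE)
    then show "g \<in> ?N ` ({..<p} \<times> ({..<p} \<times> {..<p}) \<times> {..<p})"
      using N_mod[of t] by (rule ssubst)
  qed
  moreover have "card (?N ` ({..<p} \<times> ({..<p} \<times> {..<p}) \<times> {..<p})) \<le> p ^ 4"
    by (rule order_trans[OF card_image_le])
      (simp_all add: card_cartesian_product power4_eq_xxxx mult.assoc)
  ultimately show ?thesis
    by (meson card_mono finite_SigmaI finite_imageI finite_lessThan finite_subset order_trans)
qed

section \<open>The concrete group\<close>

lemma mod_mod_cong: "a mod c = a' mod c \<Longrightarrow> (a mod c) mod c = a' mod c"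
  for a :: "'a :: euclidean_ring_cancel"
  by simp

text \<open>
  Resolution with these rules erases every inner \<open>mod\<close> from \<open>a mod c = ?a mod c\<close>; the order
  matters, since reflexivity applies to every such goal. Unqualified, \<open>refl\<close> would be the
  introduction rule of \<^const>\<open>pres_eq\<close>.
\<close>

lemmas mod_congs = mod_mod_cong mod_add_cong mod_diff_cong mod_mult_cong mod_minus_cong HOL.refl

text \<open>Here \<open>a'\<close> and \<open>b'\<close> are the expressions left after the
  congruence rules have erased the inner residues. An identity of residues thus reduces to a
  polynomial identity over the integers.\<close>

lemma mod_eq_via:
  fixes a :: "'a :: euclidean_ring_cancel"
  shows "a mod c = a' mod c \<Longrightarrow> b mod c = b' mod c \<Longrightarrow> a' = b' \<Longrightarrow> a mod c = b mod c"
  by simp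

section \<open>The semidirect product in coordinates\<close>

lemma G4_product_simps:
  assumes "p > 0"
  shows "carrier (G4_product p) = {0..<int p} \<times> ({0..<int p} \<times> {0..<int p}) \<times> {0..<int p}"
    and "(l, (x, y), k) \<otimes>\<^bsub>G4_product p\<^esub> (l', (x', y'), k') =
      ((l + l') mod int p, ((x + x') mod int p, (y + y' + k * x') mod int p), (k + k') mod int p)"
    and "\<one>\<^bsub>G4_product p\<^esub> = (0, (0, 0), 0)"
  using assms
  by (simp_all add: G4_product_def Let_def semidirect_def carrier_integer_mod_group shear_def
      mod_simps algebra_simps)

lemma group_G4_product:
  assumes "p > 0"
  shows "group (G4_product p)"
proof (rule groupI)
  note simps = G4_product_simps[OF assms]
  fix t assume t: "t \<in> carrier (G4_product p)"
  then obtain l x y k where t_eq: "t = (l, (x, y), k)"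
    by (metis prod.exhaust)
  show "\<one>\<^bsub>G4_product p\<^esub> \<otimes>\<^bsub>G4_product p\<^esub> t = t"
    using t by (simp add: simps t_eq)
  show "\<exists>u\<in>carrier (G4_product p). u \<otimes>\<^bsub>G4_product p\<^esub> t = \<one>\<^bsub>G4_product p\<^esub>"
  proof
    \<comment> \<open>The third coordinate of the product is that of the inverse plus
      \<open>y - k * x\<close>, which forces the entry \<open>k * x - y\<close>.\<close>
    show "((- l) mod int p, ((- x) mod int p, (k * x - y) mod int p), (- k) mod int p)
        \<otimes>\<^bsub>G4_product p\<^esub> t = \<one>\<^bsub>G4_product p\<^esub>"
    proof -
      have "((k * x - y) mod int p + y + (- k) mod int p * x) mod int p = 0 mod int p"
        by (rule mod_eq_via, (rule mod_congs)+, simp)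
      then show ?thesis
        unfolding t_eq simps by (simp add: mod_simps)
    qed
  qed (use assms in \<open>simp add: simps\<close>)
  fix u assume "u \<in> carrier (G4_product p)"
  obtain l' x' y' k' where u_eq: "u = (l', (x', y'), k')"
    by (metis prod.exhaust)
  show "t \<otimes>\<^bsub>G4_product p\<^esub> u \<in> carrier (G4_product p)"
    using assms by (simp add: simps t_eq u_eq)
  fix v assume "v \<in> carrier (G4_product p)"
  obtain l'' x'' y'' k'' where v_eq: "v = (l'', (x'', y''), k'')"
    by (metis prod.exhaust)
  show "t \<otimes>\<^bsub>G4_product p\<^esub> u \<otimes>\<^bsub>G4_product p\<^esub> v = t \<otimes>\<^bsub>G4_product p\<^esub> (u \<otimes>\<^bsub>G4_product p\<^esub> v)"
    unfolding simps t_eq u_eq v_eq prod.inject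
    by (intro conjI; rule mod_eq_via, (rule mod_congs)+, simp add: algebra_simps)
qed (use assms in \<open>simp add: G4_product_simps[OF assms]\<close>)

lemma G4_product_pow:
  assumes "p > 0"
  shows "(l, (0, 0), 0) [^]\<^bsub>G4_product p\<^esub> n = ((int n * l) mod int p, (0, 0), 0)"
    and "(0, (x, 0), 0) [^]\<^bsub>G4_product p\<^esub> n = (0, ((int n * x) mod int p, 0), 0)"
    and "(0, (0, y), 0) [^]\<^bsub>G4_product p\<^esub> n = (0, (0, (int n * y) mod int p), 0)"
    and "(0, (0, 0), k) [^]\<^bsub>G4_product p\<^esub> n = (0, (0, 0), (int n * k) mod int p)"
proof -
  interpret group "G4_product p" by (rule group_G4_product[OF assms])
  show "(l, (0, 0), 0) [^]\<^bsub>G4_product p\<^esub> n = ((int n * l) mod int p, (0, 0), 0)"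
    by (induction n) (simp_all add: G4_product_simps[OF assms] mod_simps algebra_simps)
  show "(0, (x, 0), 0) [^]\<^bsub>G4_product p\<^esub> n = (0, ((int n * x) mod int p, 0), 0)"
    by (induction n) (simp_all add: G4_product_simps[OF assms] mod_simps algebra_simps)
  show "(0, (0, y), 0) [^]\<^bsub>G4_product p\<^esub> n = (0, (0, (int n * y) mod int p), 0)"
    by (induction n) (simp_all add: G4_product_simps[OF assms] mod_simps algebra_simps)
  show "(0, (0, 0), k) [^]\<^bsub>G4_product p\<^esub> n = (0, (0, 0), (int n * k) mod int p)"
    by (induction n) (simp_all add: G4_product_simps[OF assms] mod_simps algebra_simps)
qed

lemma order_G4_product:
  assumes "p > 0"
  shows "order (G4_product p) = p ^ 4"
  using assms
  by (simp add: order_def G4_product_simps card_cartesian_product power4_eq_xxxx mult.assoc)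

text \<open>Von Dyck's theorem gives a homomorphism, the normal forms show that it is onto, and the
  bound on the order makes it injective.\<close>

lemma G4_iso_product:
  assumes "p > 1"
  shows "G4 p \<cong> G4_product p"
proof -
  have p: "p > 0" using assms by simp
  let ?H = "G4_product p"
  interpret H: group ?H by (rule group_G4_product[OF p])
  note simps = G4_product_simps[OF p]
  define a b c d :: "int \<times> (int \<times> int) \<times> int"
    where abcd: "a = (0, (0, 0), 1)" "b = (0, (1, 0), 0)" "c = (0, (0, 1), 0)" "d = (1, (0, 0), 0)"
  have car: "a \<in> carrier ?H" "b \<in> carrier ?H" "c \<in> carrier ?H" "d \<in> carrier ?H"
    using assms by (simp_all add: abcd simps)
  define f where "f = gen_image a b d"
  have f: "f x \<in> carrier ?H" for x
    using car by (cases x) (simp_all add: f_def)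
  \<comment> \<open>Both sides are \<open>(0, (1, 1), 1)\<close>, so \<open>c\<close> really is the
    commutator of the chosen images.\<close>
  have "a \<otimes>\<^bsub>?H\<^esub> b = (b \<otimes>\<^bsub>?H\<^esub> a) \<otimes>\<^bsub>?H\<^esub> c"
    using assms by (simp add: abcd simps)
  then have c: "inv\<^bsub>?H\<^esub> (b \<otimes>\<^bsub>?H\<^esub> a) \<otimes>\<^bsub>?H\<^esub> (a \<otimes>\<^bsub>?H\<^esub> b) = c"
    using car by (metis H.inv_solve_left H.m_closed)
  have rel: "\<forall>r\<in>G4_relators p. word_eval ?H f r = \<one>\<^bsub>?H\<^esub>"
    unfolding H.G4_relators_iff[OF f]
    using assms by (simp add: f_def c) (simp add: abcd simps G4_product_pow[OF p])
  have "\<exists>\<phi>\<in>hom (G4 p) ?H. \<forall>w. \<phi> (pres_rel (G4_relators p) `` {w}) = word_eval ?H f w"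
    unfolding G4_def by (rule H.presented_group_hom[OF f bspec[OF rel]])
  then obtain \<phi> where \<phi>: "\<phi> \<in> hom (G4 p) ?H"
    and "\<forall>w. \<phi> (pres_rel (G4_relators p) `` {w}) = word_eval ?H f w"
    by (rule bexE)
  then have \<phi>_eval: "\<phi> (pres_rel (G4_relators p) `` {w}) = word_eval ?H f w" for w
    by simp
  have "carrier ?H \<subseteq> \<phi> ` carrier (G4 p)"
  proof
    fix t assume t: "t \<in> carrier ?H"
    obtain l x y k where t_eq: "t = (l, (x, y), k)"
      by (metis prod.exhaust)
    \<comment> \<open>The word for \<open>d^l b^x c^y a^k\<close>. No twist occurs when it is
      evaluated, because every factor to the left of the power of \<open>a\<close> has last
      coordinate 0; the exponents are the coordinates.\<close>
    let ?w = "pow_word (gen Gen_d) (nat l) @ pow_word (gen Gen_b) (nat x) @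
      pow_word (comm_word (gen Gen_a) (gen Gen_b)) (nat y) @ pow_word (gen Gen_a) (nat k)"
    have "word_eval ?H f ?w =
      d [^]\<^bsub>?H\<^esub> nat l \<otimes>\<^bsub>?H\<^esub> (b [^]\<^bsub>?H\<^esub> nat x \<otimes>\<^bsub>?H\<^esub> (c [^]\<^bsub>?H\<^esub> nat y \<otimes>\<^bsub>?H\<^esub> a [^]\<^bsub>?H\<^esub> nat k))"
      by (simp add: H.word_eval_append[OF f] H.word_eval_pow_word[OF f] H.word_eval_comm_word[OF f]
          H.word_eval_gen[OF f])
        (simp add: f_def c)
    also have "\<dots> = t"
      using t by (simp add: t_eq abcd simps G4_product_pow[OF p])
    finally have "\<phi> (pres_rel (G4_relators p) `` {?w}) = t"
      unfolding \<phi>_eval .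
    moreover have "pres_rel (G4_relators p) `` {?w} \<in> carrier (G4 p)"
      unfolding G4_def presented_group_carrier by (rule rangeI)
    ultimately show "t \<in> \<phi> ` carrier (G4 p)"
      by (metis imageI)
  qed
  moreover have "\<phi> ` carrier (G4 p) \<subseteq> carrier ?H"
    using \<phi> by (auto simp: hom_def)
  ultimately have surj: "\<phi> ` carrier (G4 p) = carrier ?H"
    by blast
  have fin: "finite (carrier (G4 p))" and le: "card (carrier (G4 p)) \<le> card (\<phi> ` carrier (G4 p))"
    using card_G4_le[OF p] order_G4_product[OF p] by (simp_all add: surj order_def)
  \<comment> \<open>A map from a finite set with at most \<open>p ^ 4\<close> elements onto one with
    exactly \<open>p ^ 4\<close> is injective.\<close>
  have "inj_on \<phi> (carrier (G4 p))"
    using fin le by (intro eq_card_imp_inj_on) (auto intro: le_antisym card_image_le)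
  with \<phi> surj have "\<phi> \<in> iso (G4 p) ?H"
    by (simp add: iso_def bij_betw_def)
  then show ?thesis by (rule is_isoI)
qed

section \<open>The nearring\<close>

text \<open>The product of \<open>t\<close> and \<open>u\<close> is \<phi> applied to
  \<open>u\<close>, where \<phi> is the endomorphism attached to \<open>t\<close>. Applying \<phi>
  to two summands multiplies the alternating term \<open>k * x' - x * k'\<close> by the square of
  the last coordinate of \<open>t\<close>; hence the factor \<open>k * k\<close> at
  \<open>y'\<close>.\<close>

definition G4_nearring :: "nat \<Rightarrow> (int \<times> (int \<times> int) \<times> int) ring" where
  "G4_nearring p =
     \<lparr>carrier = {0..<int p} \<times> ({0..<int p} \<times> {0..<int p}) \<times> {0..<int p},
      monoid.mult = (\<lambda>(l, (x, y), k) (l', (x', y'), k').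
        ((l * k' + k * l') mod int p,
         ((x * k' + k * x') mod int p, (y * k' + k * k * y') mod int p),
         (k * k') mod int p)),
      one = (0, (0, 0), 1),
      zero = (0, (0, 0), 0),
      add = (\<lambda>(l, (x, y), k) (l', (x', y'), k').
        ((l + l') mod int p,
         ((x + x') mod int p, (y + y' + k * x' - x * k') mod int p),
         (k + k') mod int p))\<rparr>"

lemma G4_nearring_simps:
  shows "carrier (G4_nearring p) = {0..<int p} \<times> ({0..<int p} \<times> {0..<int p}) \<times> {0..<int p}"
    and "(l, (x, y), k) \<otimes>\<^bsub>G4_nearring p\<^esub> (l', (x', y'), k') =
        ((l * k' + k * l') mod int p,
         ((x * k' + k * x') mod int p, (y * k' + k * k * y') mod int p),
         (k * k') mod int p)"
    and "\<one>\<^bsub>G4_nearring p\<^esub> = (0, (0, 0), 1)"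
    and "\<zero>\<^bsub>G4_nearring p\<^esub> = (0, (0, 0), 0)"
    and "(l, (x, y), k) \<oplus>\<^bsub>G4_nearring p\<^esub> (l', (x', y'), k') =
        ((l + l') mod int p,
         ((x + x') mod int p, (y + y' + k * x' - x * k') mod int p),
         (k + k') mod int p)"
  by (simp_all add: G4_nearring_def)

text \<open>The substitution of \<open>2 * y - k * x\<close> for \<open>y\<close> turns the cocycle
  \<open>k * x'\<close> into \<open>2 * k * x' - (k + k') * (x + x') + k * x + k' * x' = k * x' - x
  * k'\<close>. It is invertible because 2 is a unit modulo an odd \<open>p\<close>.\<close>

lemma G4_product_iso_nearring:
  assumes "odd p"
  shows "(\<lambda>(l, (x, y), k). (l, (x, (2 * y - k * x) mod int p), k))
    \<in> iso (G4_product p) (add_monoid (G4_nearring p))" (is "?h \<in> _")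
proof -
  have p: "p > 0" using assms by (rule odd_pos)
  note simps = G4_product_simps[OF p] G4_nearring_simps
  have hom: "?h \<in> hom (G4_product p) (add_monoid (G4_nearring p))"
  proof (rule homI)
    fix t u :: "int \<times> (int \<times> int) \<times> int" assume t: "t \<in> carrier (G4_product p)"
    obtain l x y k l' x' y' k' where eq: "t = (l, (x, y), k)" "u = (l', (x', y'), k')"
      by (metis prod.exhaust)
    show "?h t \<in> carrier (add_monoid (G4_nearring p))"
      using t p by (simp add: simps eq)
    show "?h (t \<otimes>\<^bsub>G4_product p\<^esub> u) = ?h t \<otimes>\<^bsub>add_monoid (G4_nearring p)\<^esub> ?h u"
      unfolding monoid.simps simps eq prod.inject prod.case
      by (intro conjI; rule mod_eq_via, (rule mod_congs)+, (simp add: algebra_simps)?)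
  qed
  have "inj_on ?h (carrier (G4_product p))"
  proof (rule inj_onI)
    fix t u assume tu: "t \<in> carrier (G4_product p)" "u \<in> carrier (G4_product p)" "?h t = ?h u"
    obtain l x y k l' x' y' k' where eq: "t = (l, (x, y), k)" "u = (l', (x', y'), k')"
      by (metis prod.exhaust)
    have "l = l'" "x = x'" "k = k'" and "(2 * y - k * x) mod int p = (2 * y' - k * x) mod int p"
      using tu(3) by (auto simp: eq)
    then have "int p dvd 2 * (y - y')"
      by (simp add: mod_eq_dvd_iff algebra_simps)
    moreover have "coprime (int p) 2"
      using assms by (simp add: coprime_commute)
    ultimately have "int p dvd y - y'"
      using coprime_dvd_mult_right_iff by blast
    then have "y mod int p = y' mod int p"
      by (simp add: mod_eq_dvd_iff)
    then have "y = y'"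
      using tu(1,2) by (simp add: simps eq)
    with \<open>l = l'\<close> \<open>x = x'\<close> \<open>k = k'\<close> show "t = u"
      by (simp add: eq)
  qed
  \<comment> \<open>Both groups have the same finite carrier, so injectivity gives
    surjectivity.\<close>
  moreover have "?h ` carrier (G4_product p) = carrier (G4_product p)"
  proof (rule endo_inj_surj)
    show "?h ` carrier (G4_product p) \<subseteq> carrier (G4_product p)"
      using p by (auto simp: simps)
  qed (simp add: simps, fact)
  ultimately have "bij_betw ?h (carrier (G4_product p)) (carrier (add_monoid (G4_nearring p)))"
    by (simp add: bij_betw_def simps)
  with hom show ?thesis by (simp add: iso_def)
qed

lemma nearring_with_identity_G4_nearring:
  assumes "p > 1" and "odd p"
  shows "nearring_with_identity (G4_nearring p)"
proof -
  let ?R = "G4_nearring p"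
  note simps = G4_nearring_simps
  have p: "p > 0" using assms by simp
  \<comment> \<open>The group axioms are carried over along the isomorphism from the semidirect
    product.\<close>
  have grp: "group (add_monoid ?R)"
    using group.iso_imp_img_group[OF group_G4_product[OF p] G4_product_iso_nearring[OF assms(2)]]
    by (simp add: G4_product_simps[OF p] G4_nearring_def)
  have closed: "t \<otimes>\<^bsub>?R\<^esub> u \<in> carrier ?R" for t u
    using p by (cases t; cases u) (auto simp: simps)
  have assoc: "(t \<otimes>\<^bsub>?R\<^esub> u) \<otimes>\<^bsub>?R\<^esub> v = t \<otimes>\<^bsub>?R\<^esub> (u \<otimes>\<^bsub>?R\<^esub> v)" for t u v
  proof -
    obtain l x y k l' x' y' k' l'' x'' y'' k''
      where eq: "t = (l, (x, y), k)" "u = (l', (x', y'), k')" "v = (l'', (x'', y''), k'')"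
      by (metis prod.exhaust)
    show ?thesis
      unfolding eq simps prod.inject
      by (intro conjI; rule mod_eq_via, (rule mod_congs)+, simp add: algebra_simps)
  qed
  have distrib: "t \<otimes>\<^bsub>?R\<^esub> (u \<oplus>\<^bsub>?R\<^esub> v) = t \<otimes>\<^bsub>?R\<^esub> u \<oplus>\<^bsub>?R\<^esub> t \<otimes>\<^bsub>?R\<^esub> v" for t u v
  proof -
    obtain l x y k l' x' y' k' l'' x'' y'' k''
      where eq: "t = (l, (x, y), k)" "u = (l', (x', y'), k')" "v = (l'', (x'', y''), k'')"
      by (metis prod.exhaust)
    show ?thesis
      unfolding eq simps prod.inject
      by (intro conjI; rule mod_eq_via, (rule mod_congs)+, simp add: algebra_simps)
  qed
  have "nearring ?R"
    by (intro nearring.intro grp closed assoc distrib)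
  moreover have "monoid ?R"
    using closed assoc assms by unfold_locales (auto simp: simps)
  ultimately show ?thesis
    by (rule nearring_with_identity.intro)
qed

text \<open>The last coordinate is multiplicative, so it cannot vanish on a unit. Conversely, a
  tuple with nonzero last coordinate has a right inverse of the same kind, which again has a right
  inverse; in a monoid this makes the tuple a unit.\<close>

lemma Units_G4_nearring:
  assumes "prime p" and "odd p"
  shows "Units (G4_nearring p) = {t \<in> carrier (G4_nearring p). snd (snd t) \<noteq> 0}"
proof -
  let ?R = "G4_nearring p"
  note simps = G4_nearring_simps
  have p: "p > 1" using assms(1) by (rule prime_gt_1_nat)
  interpret monoid ?R
    using nearring_with_identity_G4_nearring[OF p assms(2)]
    by (simp add: nearring_with_identity_def)
  have right_inv: "\<exists>u\<in>carrier ?R. snd (snd u) \<noteq> 0 \<and> t \<otimes>\<^bsub>?R\<^esub> u = \<one>\<^bsub>?R\<^esub>"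
    if t: "t \<in> carrier ?R" "snd (snd t) \<noteq> 0" for t
  proof -
    obtain l x y k where t_eq: "t = (l, (x, y), k)"
      by (metis prod.exhaust)
    have "\<not> int p dvd k"
      using t by (auto simp: t_eq simps dest: zdvd_imp_le)
    then have "coprime (int p) k"
      using prime_imp_coprime[of "int p" k] assms(1) by simp
    then obtain m' z where "m' * int p + z * k = 1"
      using bezout_int[of "int p" k] by (auto simp: coprime_iff_gcd_eq_1)
    define m where "m = - m'"
    then have z: "k * z = 1 + int p * m"
      using \<open>m' * int p + z * k = 1\<close> by (simp add: algebra_simps)
    \<comment> \<open>With \<open>z\<close> inverse to \<open>k\<close>, the equations
      \<open>l * z + k * l' = 0\<close>, its analogue for \<open>x\<close>, and
      \<open>y * z + k * k * y' = 0\<close> modulo \<open>p\<close> are solved for the primed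
      entries.\<close>
    let ?u = "((- (l * z * z)) mod int p, ((- (x * z * z)) mod int p, (- (y * z * z * z)) mod int p), z mod int p)"
    have "t \<otimes>\<^bsub>?R\<^esub> ?u = \<one>\<^bsub>?R\<^esub>"
    proof -
      \<comment> \<open>The variable \<open>w\<close> serves both \<open>l\<close> and
        \<open>x\<close>.\<close>
      have w: "w * z + k * - (w * z * z) = int p * - (m * w * z)" for w
      proof -
        have "w * z + k * - (w * z * z) = w * z * (1 - k * z)"
          by (simp add: algebra_simps)
        then show ?thesis by (simp add: z)
      qed
      have y: "y * z + k * k * - (y * z * z * z) = int p * - (m * y * z * (2 + int p * m))"
      proof -
        have "y * z + k * k * - (y * z * z * z) = y * z * (1 - (k * z) * (k * z))"
          by (simp add: algebra_simps)
        then show ?thesis unfolding z by (simp add: algebra_simps)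
      qed
      have "(w * (z mod int p) + k * ((- (w * z * z)) mod int p)) mod int p
          = (int p * - (m * w * z)) mod int p" for w
        by (rule mod_eq_via, (rule mod_congs)+, rule w)
      moreover have "(y * (z mod int p) + k * k * ((- (y * z * z * z)) mod int p)) mod int p
          = (int p * - (m * y * z * (2 + int p * m))) mod int p"
        by (rule mod_eq_via, (rule mod_congs)+, rule y)
      moreover have "(k * (z mod int p)) mod int p = 1"
        using p by (simp add: mod_simps z)
      ultimately show ?thesis
        unfolding t_eq simps by simp
    qed
    moreover have "z mod int p \<noteq> 0"
    proof
      assume "z mod int p = 0"
      then have "int p dvd k * z - int p * m" by auto
      then show False using p z by simp
    qed
    ultimately show ?thesis
      using p by (intro bexI[of _ ?u]) (auto simp: simps)
  qed
  show ?thesis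
  proof (intro equalityI subsetI)
    fix t assume "t \<in> Units ?R"
    then obtain u where t: "t \<in> carrier ?R" and tu: "t \<otimes>\<^bsub>?R\<^esub> u = \<one>\<^bsub>?R\<^esub>"
      by (auto simp: Units_def)
    from tu have "snd (snd t) \<noteq> 0"
      by (cases t; cases u) (auto simp: simps)
    with t show "t \<in> {t \<in> carrier ?R. snd (snd t) \<noteq> 0}" by simp
  next
    fix t assume "t \<in> {t \<in> carrier ?R. snd (snd t) \<noteq> 0}"
    then have t: "t \<in> carrier ?R" "snd (snd t) \<noteq> 0" by simp_all
    obtain u where u: "u \<in> carrier ?R" "snd (snd u) \<noteq> 0" "t \<otimes>\<^bsub>?R\<^esub> u = \<one>\<^bsub>?R\<^esub>"
      using right_inv[OF t] by blast
    obtain v where v: "v \<in> carrier ?R" "u \<otimes>\<^bsub>?R\<^esub> v = \<one>\<^bsub>?R\<^esub>"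
      using right_inv[OF u(1,2)] by blast
    \<comment> \<open>Left and right inverse of \<open>u\<close> agree, so \<open>u\<close> is a
      two-sided inverse of \<open>t\<close>.\<close>
    have "t = v"
      using inv_unique[OF u(3) v(2)] t u v by simp
    then show "t \<in> Units ?R"
      using t u v by (auto simp: Units_def)
  qed
qed

text \<open>The last coordinate adds without a twist, so it is a homomorphism to the cyclic group of
  order \<open>p\<close>; its kernel is the set of non-units.\<close>

lemma local_nearring_G4_nearring:
  assumes "prime p" and "odd p"
  shows "local_nearring (G4_nearring p)"
proof -
  let ?R = "G4_nearring p"
  have p: "p > 1" using assms(1) by (rule prime_gt_1_nat)
  interpret R: nearring_with_identity ?R
    by (rule nearring_with_identity_G4_nearring[OF p assms(2)])
  have "(\<lambda>t. snd (snd t)) \<in> hom (add_monoid ?R) (integer_mod_group p)"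
    using p by (intro homI) (auto simp: G4_nearring_simps carrier_integer_mod_group)
  then interpret K: group_hom "add_monoid ?R" "integer_mod_group p" "\<lambda>t. snd (snd t)"
    using R.additive_group by (simp add: group_hom_def group_hom_axioms_def)
  have "carrier ?R - Units ?R = kernel (add_monoid ?R) (integer_mod_group p) (\<lambda>t. snd (snd t))"
    unfolding Units_G4_nearring[OF assms] by (auto simp: kernel_def)
  then show ?thesis
    using K.subgroup_kernel R.nearring_with_identity_axioms
    by (simp add: local_nearring_def local_nearring_axioms_def)
qed

section \<open>Transport of structure\<close>

lemma image_ring_simps:
  assumes "inj_on f (carrier R)"
  shows "carrier (image_ring f R) = f ` carrier R"
    and "\<one>\<^bsub>image_ring f R\<^esub> = f \<one>\<^bsub>R\<^esub>"
    and "\<zero>\<^bsub>image_ring f R\<^esub> = f \<zero>\<^bsub>R\<^esub>"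
    and "\<lbrakk>x \<in> carrier R; y \<in> carrier R\<rbrakk> \<Longrightarrow> f x \<otimes>\<^bsub>image_ring f R\<^esub> f y = f (x \<otimes>\<^bsub>R\<^esub> y)"
    and "\<lbrakk>x \<in> carrier R; y \<in> carrier R\<rbrakk> \<Longrightarrow> f x \<oplus>\<^bsub>image_ring f R\<^esub> f y = f (x \<oplus>\<^bsub>R\<^esub> y)"
  using assms by (simp_all add: image_ring_def image_group_def monoid.defs)

lemma (in nearring) image_ring_add_iso:
  assumes "inj_on f (carrier R)"
  shows "f \<in> iso (add_monoid R) (add_monoid (image_ring f R))"
  using assms by (auto simp: iso_def hom_def bij_betw_def image_ring_simps)

text \<open>An injection preserves and reflects being a unit, so the non-units of the copy are the
  image of a subgroup under an additive homomorphism.\<close>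

lemma (in local_nearring) local_nearring_image_ring:
  assumes inj: "inj_on f (carrier R)"
  shows "local_nearring (image_ring f R)"
proof -
  let ?S = "image_ring f R"
  note simps = image_ring_simps[OF inj]
  interpret A: group "add_monoid R" by (rule additive_group)
  have add_closed: "x \<oplus> y \<in> carrier R" if "x \<in> carrier R" "y \<in> carrier R" for x y
    using A.m_closed that by simp
  have grp: "group (add_monoid ?S)"
    using A.iso_imp_img_group[OF image_ring_add_iso[OF inj]] by (simp add: simps)
  have near: "nearring ?S"
    by (intro nearring.intro grp)
      (auto simp: simps mult_closed add_closed mult_assoc left_distrib)
  have mon: "monoid ?S"
    by unfold_locales (auto simp: simps m_assoc)
  interpret S: nearring_with_identity ?S
    using near mon by (rule nearring_with_identity.intro)
  have "f x \<in> Units ?S \<longleftrightarrow> x \<in> Units R" if "x \<in> carrier R" for x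
    using that by (auto simp: Units_def simps inj_on_eq_iff[OF inj])
  then have "carrier ?S - Units ?S = f ` (carrier R - Units R)"
    by (auto simp: simps)
  moreover have "group_hom (add_monoid R) (add_monoid ?S) f"
    using image_ring_add_iso[OF inj] grp A.group_axioms
    by (simp add: group_hom_def group_hom_axioms_def iso_def)
  ultimately have "subgroup (carrier ?S - Units ?S) (add_monoid ?S)"
    using group_hom.subgroup_img_is_subgroup[OF _ nonunits_subgroup] by simp
  then show ?thesis
    by (simp add: local_nearring_def local_nearring_axioms_def S.nearring_with_identity_axioms)
qed

theorem theorem4:
  fixes p :: nat
  assumes "prime p" and "odd p"
  shows "(\<exists>R :: nat ring. local_nearring R \<and> add_monoid R \<cong> G4 p) \<and>
    G4 p \<cong> G4_product p \<and> order (G4 p) = p ^ 4"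
proof -
  have p: "p > 1" using assms(1) by (rule prime_gt_1_nat)
  then have p0: "p > 0" by simp
  have G4: "group (G4 p)"
    unfolding G4_def by (rule group_presented_group)
  note iso = G4_iso_product[OF p]
  interpret R: local_nearring "G4_nearring p"
    by (rule local_nearring_G4_nearring[OF assms])
  \<comment> \<open>The tuples form a countable type, so \<open>to_nat\<close> yields a copy of the
    nearring on natural numbers, the type over which existence is claimed.\<close>
  let ?S = "image_ring to_nat (G4_nearring p) :: nat ring"
  have inj: "inj_on (to_nat :: int \<times> (int \<times> int) \<times> int \<Rightarrow> nat) (carrier (G4_nearring p))"
    by simp
  have "G4 p \<cong> add_monoid (G4_nearring p)"
    using iso is_isoI[OF G4_product_iso_nearring[OF assms(2)]] by (rule iso_trans)
  also have "\<dots> \<cong> add_monoid ?S"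
    by (rule is_isoI[OF R.image_ring_add_iso[OF inj]])
  finally have "add_monoid ?S \<cong> G4 p"
    by (rule group.iso_sym[OF G4])
  moreover have "local_nearring ?S"
    by (rule R.local_nearring_image_ring[OF inj])
  moreover have "order (G4 p) = p ^ 4"
    using iso_same_order order_G4_product[OF p0] iso unfolding is_iso_def by fastforce
  ultimately show ?thesis
    using iso by blast
qed

end
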